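(* As $t \to \infty$, $$r(K_5^{3-}, K_t^3) = 2^{O(t^2 \log t)}.$$ That is, there is a constant $C>0$ such that $r(K_5^{3-}, K_t^3) \le 2^{C t^2 \log t}$ for all sufficiently large integers $t$.
   Context: A $3$-graph (triple system) $H$ with vertex set $V(H)$ is a collection of $3$-element subsets of $V(H)$, called edges. $K_n^3$ is the complete $3$-graph on $n$ vertices (all $3$-subsets are edges). $K_5^{3-}$ is the $3$-graph obtained from $K_5^3$ by deleting one edge. For $3$-graphs $F, G$, the Ramsey number $r(F,G)$ is the minimum $n$ such that every coloring of the edges of $K_n^3$ with colors red and blue contains a copy of $F$ (as a not necessarily induced subhypergraph) all of whose edges are red, or a copy of $G$ all of whose edges are blue. *)

theory Defs
  imports Complex_Main "HOL-Library.Ramsey"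
begin

text \<open>A hypergraph is a pair of a vertex set and an edge set.\<close>

type_synonym 'a hypergraph = "'a set \<times> 'a set set"

abbreviation verts :: "'a hypergraph \<Rightarrow> 'a set" where
  "verts H \<equiv> fst H"

abbreviation edges :: "'a hypergraph \<Rightarrow> 'a set set" where
  "edges H \<equiv> snd H"

definition three_graph :: "'a hypergraph \<Rightarrow> bool" where
  "three_graph H \<longleftrightarrow> edges H \<subseteq> [verts H]\<^bsup>3\<^esup>"

definition complete3 :: "nat \<Rightarrow> nat hypergraph" where
  "complete3 n = ({..<n}, [{..<n}]\<^bsup>3\<^esup>)"

definition delete_edge :: "'a hypergraph \<Rightarrow> 'a set \<Rightarrow> 'a hypergraph" where
  "delete_edge H e = (verts H, edges H - {e})"

text \<open>All choices of the deleted edge give isomorphic 3-graphs.\<close>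

definition K5_minus :: "nat hypergraph" where
  "K5_minus = delete_edge (complete3 5) {0, 1, 2}"

definition contains_copy :: "'b hypergraph \<Rightarrow> 'a hypergraph \<Rightarrow> bool" where
  "contains_copy H F \<longleftrightarrow>
     (\<exists>\<phi>. inj_on \<phi> (verts F) \<and> \<phi> ` verts F \<subseteq> verts H \<and> (\<forall>e\<in>edges F. \<phi> ` e \<in> edges H))"

datatype colour = Red | Blue

text \<open>A colouring is a total function on sets of vertices; only its values on the edges of
  \<open>H\<close> matter in the following definition.\<close>

definition colour_class :: "'a hypergraph \<Rightarrow> ('a set \<Rightarrow> colour) \<Rightarrow> colour \<Rightarrow> 'a hypergraph" where
  "colour_class H c k = (verts H, {e \<in> edges H. c e = k})"

definition ramsey_arrow :: "nat \<Rightarrow> 'a hypergraph \<Rightarrow> 'b hypergraph \<Rightarrow> bool" where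
  "ramsey_arrow n F G \<longleftrightarrow>
     (\<forall>c. contains_copy (colour_class (complete3 n) c Red) F \<or>
          contains_copy (colour_class (complete3 n) c Blue) G)"

definition ramsey_number :: "'a hypergraph \<Rightarrow> 'b hypergraph \<Rightarrow> nat" where
  "ramsey_number F G = (LEAST n. ramsey_arrow n F G)"

lemma three_graph_complete3: "three_graph (complete3 n)"
  by (simp add: three_graph_def complete3_def)

lemma three_graph_K5_minus: "three_graph K5_minus"
  by (auto simp: three_graph_def complete3_def K5_minus_def delete_edge_def)

lemma contains_copy_clique:
  assumes "three_graph F" "finite (verts F)" "U \<subseteq> verts H" "finite U"
    and "card U = card (verts F)" "[U]\<^bsup>3\<^esup> \<subseteq> edges H"
  shows "contains_copy H F"
proof -
  obtain \<phi> where \<phi>: "bij_betw \<phi> (verts F) U"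
    using assms(2,4,5) finite_same_card_bij by metis
  then have inj: "inj_on \<phi> (verts F)" and im: "\<phi> ` verts F = U"
    by (auto simp: bij_betw_def)
  have "\<phi> ` e \<in> edges H" if "e \<in> edges F" for e
  proof -
    from that assms(1) have e: "e \<subseteq> verts F" "finite e" "card e = 3"
      by (auto simp: three_graph_def nsets_def)
    then have "\<phi> ` e \<in> [U]\<^bsup>3\<^esup>"
      using im card_image[OF inj_on_subset[OF inj e(1)]] by (auto simp: nsets_def)
    with assms(6) show ?thesis by blast
  qed
  with inj im assms(3) show ?thesis
    unfolding contains_copy_def by blast
qed

text \<open>The set over which the minimum in the Ramsey number is taken is nonempty.\<close>

lemma ramsey_arrow_exists:
  assumes F: "three_graph F" "finite (verts F)" and G: "three_graph G" "finite (verts G)"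
  shows "\<exists>n. ramsey_arrow n F G"
proof -
  obtain N :: nat where N: "partn_lst {..<N} [card (verts F), card (verts G)] 3"
    using ramsey_full by blast
  have "contains_copy (colour_class (complete3 N) c Red) F \<or>
        contains_copy (colour_class (complete3 N) c Blue) G" for c
  proof -
    define f :: "nat set \<Rightarrow> nat" where "f = (\<lambda>e. if c e = Red then 0 else 1)"
    have "f \<in> [{..<N}]\<^bsup>3\<^esup> \<rightarrow> {..<2}"
      by (auto simp: f_def)
    then obtain i U where i: "i < 2" and U: "U \<in> [{..<N}]\<^bsup>([card (verts F), card (verts G)] ! i)\<^esup>"
      and mono: "f ` [U]\<^bsup>3\<^esup> \<subseteq> {i}"
      using partn_lstE[OF N] by (metis length_Cons list.size(3) numeral_2_eq_2)
    have sub: "U \<subseteq> {..<N}" "finite U"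
      using U by (auto simp: nsets_def)
    have edge: "e \<in> [{..<N}]\<^bsup>3\<^esup> \<and> f e = i" if "e \<in> [U]\<^bsup>3\<^esup>" for e
      using that mono nsets_mono[OF sub(1)] by blast
    consider "i = 0" | "i = 1" using i by linarith
    then show ?thesis
    proof cases
      case 1
      have "c e = Red" if "e \<in> [U]\<^bsup>3\<^esup>" for e
        using edge[OF that] 1 by (auto simp: f_def split: if_splits)
      then have "[U]\<^bsup>3\<^esup> \<subseteq> edges (colour_class (complete3 N) c Red)"
        using edge by (auto simp: colour_class_def complete3_def)
      then have "contains_copy (colour_class (complete3 N) c Red) F"
        using U 1 sub
        by (intro contains_copy_clique[OF F, of U])
           (auto simp: nsets_def colour_class_def complete3_def)
      then show ?thesis ..
    next
      case 2
      have "c e = Blue" if "e \<in> [U]\<^bsup>3\<^esup>" for e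
        using edge[OF that] 2 by (cases "c e") (auto simp: f_def)
      then have "[U]\<^bsup>3\<^esup> \<subseteq> edges (colour_class (complete3 N) c Blue)"
        using edge by (auto simp: colour_class_def complete3_def)
      then have "contains_copy (colour_class (complete3 N) c Blue) G"
        using U 2 sub
        by (intro contains_copy_clique[OF G, of U])
           (auto simp: nsets_def colour_class_def complete3_def)
      then show ?thesis ..
    qed
  qed
  then show ?thesis
    unfolding ramsey_arrow_def by blast
qed

lemma ramsey_arrow_K5_minus_complete3: "\<exists>n. ramsey_arrow n K5_minus (complete3 t)"
  by (intro ramsey_arrow_exists three_graph_K5_minus three_graph_complete3)
     (simp_all add: K5_minus_def delete_edge_def complete3_def)

end

theory Submission
  imports Defs "HOL-Library.Sublist"
begin

text \<open>Following Erdos--Rado and Conlon--Fox--Sudakov, grow a rooted binary tree of vertices together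
  with a set \<open>S\<close> of unused vertices such that the colour of a triple whose first two vertices lie on
  a branch, and whose third vertex lies further down or in \<open>S\<close>, is determined by the direction the
  branch takes at the first vertex. To add a vertex \<open>v \<in> S\<close>, let it descend from the root; at each node
  \<open>u\<close> passed, shrink \<open>S\<close> to those \<open>w\<close> for which \<open>{u, v, w}\<close> is red if they make up a fraction
  \<open>1/(2t)\<close> of \<open>S\<close>, and otherwise to those for which it is blue. Without a blue \<open>K\<^sub>t\<close> a branch has
  fewer than \<open>t\<close> blue steps. After two red steps, at \<open>a\<close> and \<open>b\<close>, a branch can contain only one more
  vertex \<open>x\<close>, as \<open>a, b\<close>, two such vertices and an element of \<open>S\<close> would span a red
  \<open>K\<^sub>5\<close> minus an edge. Hence the tree has at most \<open>3t\<^sup>2\<close> vertices, and each of them costs a factor of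
  only \<open>O(t\<^sup>3)\<close> in the size of \<open>S\<close>.\<close>

text \<open>A node of the tree is the list of directions leading to it from the root.\<close>

definition colour_tree ::
    "('a set \<Rightarrow> colour) \<Rightarrow> 'a set \<Rightarrow> colour list set \<Rightarrow> (colour list \<Rightarrow> 'a) \<Rightarrow> 'a set \<Rightarrow> bool" where
  "colour_tree c V D f S \<longleftrightarrow>
     finite D \<and> (\<forall>s\<in>D. \<forall>p. strict_prefix p s \<longrightarrow> p \<in> D) \<and>
     inj_on f D \<and> f ` D \<subseteq> V \<and> S \<subseteq> V \<and> f ` D \<inter> S = {} \<and>
     (\<forall>p q s k. q \<in> D \<longrightarrow> s \<in> D \<longrightarrow> prefix (p @ [k]) q \<longrightarrow> strict_prefix q s \<longrightarrow> c {f p, f q, f s} = k) \<and>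
     (\<forall>p q w k. q \<in> D \<longrightarrow> w \<in> S \<longrightarrow> prefix (p @ [k]) q \<longrightarrow> c {f p, f q, w} = k)"

lemma colour_treeD:
  assumes "colour_tree c V D f S"
  shows "finite D"
    and "s \<in> D \<Longrightarrow> strict_prefix p s \<Longrightarrow> p \<in> D"
    and "s \<in> D \<Longrightarrow> prefix p s \<Longrightarrow> p \<in> D"
    and "inj_on f D" and "f ` D \<subseteq> V" and "S \<subseteq> V" and "f ` D \<inter> S = {}"
    and "q \<in> D \<Longrightarrow> s \<in> D \<Longrightarrow> prefix (p @ [k]) q \<Longrightarrow> strict_prefix q s \<Longrightarrow> c {f p, f q, f s} = k"
    and "q \<in> D \<Longrightarrow> w \<in> S \<Longrightarrow> prefix (p @ [k]) q \<Longrightarrow> c {f p, f q, w} = k"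
proof -
  note T = assms[unfolded colour_tree_def]
  show "finite D" "inj_on f D" "f ` D \<subseteq> V" "S \<subseteq> V" "f ` D \<inter> S = {}"
    using T by simp_all
  show closed: "p \<in> D" if "s \<in> D" "strict_prefix p s" for p s
    using that T by blast
  show "p \<in> D" if "s \<in> D" "prefix p s"
    using that closed by (cases "p = s") (simp_all add: strict_prefix_def)
  show "c {f p, f q, f s} = k"
    if "q \<in> D" "s \<in> D" "prefix (p @ [k]) q" "strict_prefix q s"
    using that T by blast
  show "c {f p, f q, w} = k" if "q \<in> D" "w \<in> S" "prefix (p @ [k]) q"
    using that T by blast
qed

section \<open>Monochromatic configurations along a branch\<close>

text \<open>Edges are unordered, while the tree conditions and case checks speak of ordered triples.
  Applied with the identity on indices and with \<open>length\<close> on nodes.\<close>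

lemma sort_triple:
  fixes g :: "'a \<Rightarrow> nat"
  assumes "card e = 3" and "inj_on g e"
  obtains p q r where "e = {p, q, r}" and "g p < g q" and "g q < g r"
proof -
  obtain x y z where e: "e = {x, y, z}" "x \<noteq> y" "x \<noteq> z" "y \<noteq> z"
    using assms(1) by (auto simp: card_3_iff)
  then have "g x \<noteq> g y" "g x \<noteq> g z" "g y \<noteq> g z"
    using assms(2) by (auto simp: inj_on_def)
  then consider "g x < g y" "g y < g z" | "g x < g z" "g z < g y" | "g y < g x" "g x < g z"
    | "g y < g z" "g z < g x" | "g z < g x" "g x < g y" | "g z < g y" "g y < g x"
    by linarith
  then show thesis
    using that[of x y z] that[of x z y] that[of y x z] that[of y z x] that[of z x y] that[of z y x] e(1)
    by cases (simp_all add: insert_commute)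
qed

text \<open>The triple \<open>{x, y, w}\<close> becomes the deleted edge. Of the other nine, three
  contain both \<open>a\<close> and \<open>b\<close> and six contain exactly one of them.\<close>

lemma contains_K5_minus:
  fixes c :: "nat set \<Rightarrow> colour"
  assumes "{a, b, x, y, w} \<subseteq> {..<N}" and "distinct [a, b, x, y, w]"
    and "\<And>z. z \<in> {x, y, w} \<Longrightarrow> c {a, b, z} = Red"
    and "\<And>u. u \<in> {a, b} \<Longrightarrow> c {u, x, y} = Red \<and> c {u, x, w} = Red \<and> c {u, y, w} = Red"
  shows "contains_copy (colour_class (complete3 N) c Red) K5_minus"
proof -
  \<comment> \<open>The order of the list sends the deleted edge \<open>{0, 1, 2}\<close> to
    \<open>{x, y, w}\<close>.\<close>
  define \<phi> where "\<phi> = (\<lambda>i. [x, y, w, a, b] ! i)"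
  have V: "verts K5_minus = {0, 1, 2, 3, 4}"
    by (auto simp: K5_minus_def delete_edge_def complete3_def)
  have \<phi>: "\<phi> 0 = x" "\<phi> (Suc 0) = y" "\<phi> 2 = w" "\<phi> 3 = a" "\<phi> 4 = b"
    by (simp_all add: \<phi>_def)
  have inj: "inj_on \<phi> (verts K5_minus)"
    using assms(2) unfolding V by (auto simp: \<phi>)
  have im: "\<phi> ` verts K5_minus \<subseteq> {..<N}"
    using assms(1) unfolding V by (auto simp: \<phi>)
  have "\<phi> ` e \<in> edges (colour_class (complete3 N) c Red)" if e: "e \<in> edges K5_minus" for e
  proof -
    have sub: "e \<subseteq> verts K5_minus" and card: "card e = 3" "finite e" and ne: "e \<noteq> {0, 1, 2}"
      using e by (auto simp: K5_minus_def delete_edge_def complete3_def nsets_def)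
    have "\<phi> ` e \<in> [{..<N}]\<^bsup>3\<^esup>"
      using card_image[OF inj_on_subset[OF inj sub]] card im sub
      by (auto simp: nsets_def)
    moreover have "c (\<phi> ` e) = Red"
    proof -
      obtain i j k where ijk: "e = {i, j, k}" "i < j" "j < k"
        using sort_triple[OF card(1), of "\<lambda>i. i"] by auto
      have "(i, j, k) \<in> {(0,1,3),(0,1,4),(0,2,3),(0,2,4),(0,3,4),(1,2,3),(1,2,4),(1,3,4),(2,3,4)}"
      proof -
        have "i \<in> {0, 1, 2, 3, 4}" "j \<in> {0, 1, 2, 3, 4}" "k \<in> {0, 1, 2, 3, 4}"
          using sub unfolding ijk(1) V by simp_all
        moreover have "(i, j, k) \<noteq> (0, 1, 2)"
          using ne ijk(1) by blast
        ultimately show ?thesis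
          using ijk(2,3) by (elim insertE emptyE) simp_all
      qed
      then show ?thesis
        using assms(3)[of x] assms(3)[of y] assms(3)[of w] assms(4)[of a] assms(4)[of b]
        by (elim insertE emptyE) (simp_all add: ijk(1) \<phi> insert_commute)
    qed
    ultimately show ?thesis
      by (simp add: colour_class_def complete3_def)
  qed
  with inj im show ?thesis
    unfolding contains_copy_def by (auto simp: colour_class_def complete3_def)
qed

text \<open>An occurrence of \<open>k\<close> in \<open>s\<close> corresponds to the prefix ending
  just before it, so letter counts become counts of nodes where the branch to \<open>s\<close> takes
  direction \<open>k\<close>. Finiteness is carried along because the cardinality of an insertion
  needs it.\<close>

lemma card_prefixes_count_list:
  "card {p. prefix (p @ [k]) s} = count_list s k \<and> finite {p. prefix (p @ [k]) s}"
proof (induction s rule: rev_induct)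
  case (snoc x s)
  have "{p. prefix (p @ [k]) (s @ [x])} = (if x = k then insert s else id) {p. prefix (p @ [k]) s}"
    by (auto simp: prefix_snoc)
  moreover have "s \<notin> {p. prefix (p @ [k]) s}"
    by (auto simp: prefix_def)
  ultimately show ?case
    using snoc by auto
qed simp

text \<open>The nodes where the branch to \<open>s\<close> turns blue form a chain ordered by
  \<open>length\<close>. In any triple of them the shortest node fixes the colour, and it is
  blue.\<close>

lemma colour_tree_blue_clique:
  assumes T: "colour_tree c {..<N} D f S" and s: "s \<in> D" and t: "t \<le> count_list s Blue"
  shows "contains_copy (colour_class (complete3 N) c Blue) (complete3 t)"
proof -
  obtain P where P: "P \<subseteq> {p. prefix (p @ [Blue]) s}" "card P = t" "finite P"
    by (metis t card_prefixes_count_list obtain_subset_with_card_n)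
  have PD: "P \<subseteq> D"
    using P(1) append_prefixD colour_treeD(3)[OF T s] by blast
  have inj: "inj_on f P"
    using colour_treeD(4)[OF T] PD by (rule inj_on_subset)
  have im: "f ` P \<subseteq> {..<N}"
    using PD colour_treeD(5)[OF T] by blast
  have blue: "c {f p, f q, f r} = Blue"
    if "p \<in> P" "q \<in> P" "r \<in> P" "length p < length q" "length q < length r" for p q r
  proof -
    have pre: "prefix (p @ [Blue]) s" "prefix q s" "prefix r s"
      using that P(1) append_prefixD by blast+
    have "prefix (p @ [Blue]) q"
      using that(4) by (intro prefix_length_prefix[OF pre(1,2)]) simp
    moreover have "strict_prefix q r"
      using pre(2,3) that(5) prefix_length_prefix[of q s r] by (auto simp: strict_prefix_def)
    ultimately show ?thesis
      using colour_treeD(8)[OF T] that PD by blast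
  qed
  have len: "length p \<noteq> length q" if "p \<in> P" "q \<in> P" "p \<noteq> q" for p q
  proof -
    have "prefix p s" "prefix q s"
      using that P(1) append_prefixD by blast+
    then show ?thesis
      using that(3) by (metis prefix_length_prefix prefix_order.antisym order_refl)
  qed
  have "e \<in> edges (colour_class (complete3 N) c Blue)" if e: "e \<in> [f ` P]\<^bsup>3\<^esup>" for e
  proof -
    have sub: "e \<subseteq> f ` P" and card: "card e = 3"
      using e by (auto simp: nsets_def)
    obtain X where X: "X \<subseteq> P" "inj_on f X" "e = f ` X"
      using sub by (auto simp: subset_image_inj)
    have "card X = 3"
      using X(2,3) card by (simp add: card_image)
    moreover have "inj_on length X"
      using len X(1) by (meson inj_onI subsetD)
    ultimately obtain p q r where "X = {p, q, r}" "length p < length q" "length q < length r"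
      by (rule sort_triple)
    then have "c e = Blue"
      using X blue by simp
    moreover have "e \<in> [{..<N}]\<^bsup>3\<^esup>"
      using e nsets_mono[OF im] by blast
    ultimately show ?thesis
      by (simp add: colour_class_def complete3_def)
  qed
  then show ?thesis
    using P inj im
    by (intro contains_copy_clique[OF three_graph_complete3, of _ "f ` P"])
       (simp_all add: complete3_def colour_class_def card_image subset_iff)
qed

text \<open>Let \<open>p\<close>, \<open>q\<close> be two nodes where the branch to
  \<open>x = butlast s\<close> turns red. Then \<open>f p\<close>, \<open>f q\<close>,
  \<open>f x\<close>, \<open>f s\<close> and any \<open>w\<close> in \<open>S\<close> span the copy:
  only the colour of \<open>{f x, f s, w}\<close> depends on the step from \<open>x\<close> to
  \<open>s\<close>, and that triple is the deleted edge.\<close>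

lemma colour_tree_red_K5_minus:
  assumes T: "colour_tree c {..<N} D f S" and S: "S \<noteq> {}"
    and s: "s \<in> D" and r: "2 \<le> count_list (butlast s) Red"
  shows "contains_copy (colour_class (complete3 N) c Red) K5_minus"
proof -
  obtain w where w: "w \<in> S"
    using S by blast
  define x where "x = butlast s"
  have "s \<noteq> []"
    using r by auto
  then have xs: "strict_prefix x s"
    unfolding x_def by (metis append_butlast_last_id strict_prefixI')
  obtain Q where Q: "Q \<subseteq> {p. prefix (p @ [Red]) x}" "card Q = 2"
    by (metis r x_def card_prefixes_count_list obtain_subset_with_card_n)
  then obtain p' q' where "prefix (p' @ [Red]) x" "prefix (q' @ [Red]) x" "p' \<noteq> q'"
    by (auto simp: card_2_iff)
  \<comment> \<open>Nodes on one branch are comparable, so the shorter of the two takes its red step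
    towards the longer.\<close>
  moreover have "prefix (p @ [Red]) q \<or> length q \<le> length p"
    if "prefix (p @ [Red]) x" "prefix (q @ [Red]) x" for p q
    using prefix_length_prefix[OF that(1) append_prefixD[OF that(2)]] by fastforce
  moreover have "length p' \<noteq> length q'"
    using calculation(1-3) append_prefixD prefix_length_prefix[of p' x q'] prefix_length_prefix[of q' x p']
    by (metis order_refl prefix_order.antisym)
  ultimately have "\<exists>p q. prefix (p @ [Red]) q \<and> prefix (p @ [Red]) x \<and> prefix (q @ [Red]) x"
    by (metis le_antisym)
  then obtain p q where pq: "prefix (p @ [Red]) q" "prefix (p @ [Red]) x" "prefix (q @ [Red]) x"
    by blast
  have qx: "strict_prefix q x" and pq': "strict_prefix p q"
    using pq by (auto simp: strict_prefix_def prefix_def)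
  have D: "x \<in> D" "q \<in> D" "p \<in> D"
    using s xs qx pq' colour_treeD(2)[OF T] by blast+
  have ps: "prefix (p @ [Red]) s" "prefix (q @ [Red]) s" "strict_prefix q s"
    using pq xs qx by (auto simp: strict_prefix_def intro: prefix_order.trans)
  have dist: "distinct [p, q, x, s]"
    using xs qx pq' ps(3) by (auto dest: prefix_order.less_trans)
  have "distinct (map f [p, q, x, s])"
    using dist D s inj_on_subset[OF colour_treeD(4)[OF T], of "set [p, q, x, s]"]
    by (simp add: distinct_map)
  moreover have "w \<notin> f ` D" "f ` D \<subseteq> {..<N}" "w \<in> {..<N}"
    using w colour_treeD(5,6,7)[OF T] by blast+
  ultimately show ?thesis
    using D s w pq ps qx xs colour_treeD(8,9)[OF T]
    by (intro contains_K5_minus[of "f p" "f q" "f x" "f s" w]) auto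
qed

section \<open>Counting the possible nodes\<close>

text \<open>Using \<open>butlast\<close> admits a second red step, but only as the last one.\<close>

definition thin :: "nat \<Rightarrow> colour list set" where
  "thin t = {s. count_list s Blue < t \<and> count_list (butlast s) Red < 2}"

lemma count_list_Red_0: "count_list s Red = 0 \<Longrightarrow> s = replicate (count_list s Blue) Blue"
proof (induction s)
  case (Cons k s)
  then show ?case by (cases k) auto
qed simp

lemma count_list_Red_1:
  assumes "count_list s Red = 1"
  obtains i j where "s = replicate i Blue @ Red # replicate j Blue" "count_list s Blue = i + j"
proof -
  have "Red \<in> set s"
    using assms by (metis count_list_0_iff zero_neq_one)
  then obtain u v where uv: "s = u @ Red # v"
    by (meson split_list)
  then have "count_list u Red = 0" "count_list v Red = 0"
    using assms by auto
  then have "u = replicate (count_list u Blue) Blue" "v = replicate (count_list v Blue) Blue"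
    by (simp_all only: count_list_Red_0)
  moreover have "count_list s Blue = count_list u Blue + count_list v Blue"
    using uv by simp
  ultimately show thesis
    using that uv by metis
qed

text \<open>A thin list is determined by the lengths \<open>i\<close>, \<open>j\<close> of its blue
  runs before and after the first red step, both below \<open>t\<close>, and by its number
  \<open>k\<close> of red steps, at most two; a second one must come last.\<close>

lemma card_thin: "finite (thin t)" "card (thin t) \<le> 3 * t\<^sup>2"
proof -
  define g where "g = (\<lambda>(i, j, k :: nat). replicate i Blue @
    (if k = 0 then [] else Red # replicate j Blue @ (if k = 1 then [] else [Red])))"
  let ?A = "{..<t} \<times> {..<t} \<times> {..<3 :: nat}"
  have "thin t \<subseteq> g ` ?A"
  proof
    fix s assume "s \<in> thin t"
    then have B: "count_list s Blue < t" and R: "count_list (butlast s) Red < 2"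
      by (auto simp: thin_def)
    consider "count_list s Red = 0" | "count_list s Red = 1" | "count_list s Red \<ge> 2"
      by linarith
    then show "s \<in> g ` ?A"
    proof cases
      case 1
      then have "s = g (count_list s Blue, 0, 0)"
        using count_list_Red_0 by (simp add: g_def)
      then show ?thesis
        using B by (metis (no_types, lifting) SigmaI gr_implies_not_zero image_eqI lessThan_iff
            not_gr_zero zero_less_numeral)
    next
      case 2
      then obtain i j where "s = replicate i Blue @ Red # replicate j Blue" "count_list s Blue = i + j"
        by (rule count_list_Red_1)
      then have "s = g (i, j, 1)" "(i, j, 1) \<in> ?A"
        using B by (auto simp: g_def)
      then show ?thesis by blast
    next
      case 3
      then obtain u k where s: "s = u @ [k]"
        by (metis count_list.simps(1) not_numeral_le_zero rev_exhaust)
      then have k: "k = Red" "count_list u Red = 1"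
        using R 3 by (auto split: if_splits)
      obtain i j where "u = replicate i Blue @ Red # replicate j Blue" "count_list u Blue = i + j"
        using k(2) by (rule count_list_Red_1)
      then have "s = g (i, j, 2)" "(i, j, 2) \<in> ?A"
        using B k s by (auto simp: g_def)
      then show ?thesis by blast
    qed
  qed
  moreover have "finite ?A" "card ?A = 3 * t\<^sup>2"
    by (auto simp: card_cartesian_product power2_eq_square)
  ultimately show "finite (thin t)" "card (thin t) \<le> 3 * t\<^sup>2"
    by (metis finite_imageI finite_subset)
       (metis \<open>card ?A = _\<close> \<open>finite ?A\<close> \<open>thin t \<subseteq> _\<close> card_image_le card_mono finite_imageI le_trans)
qed

lemma colour_tree_thin:
  assumes "colour_tree c {..<N} D f S" and "S \<noteq> {}"
    and "\<not> contains_copy (colour_class (complete3 N) c Red) K5_minus"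
    and "\<not> contains_copy (colour_class (complete3 N) c Blue) (complete3 t)"
  shows "D \<subseteq> thin t"
proof
  fix s assume s: "s \<in> D"
  show "s \<in> thin t"
    using colour_tree_blue_clique[OF assms(1) s, of t] colour_tree_red_K5_minus[OF assms(1,2) s]
      assms(3,4)
    unfolding thin_def by (simp add: not_le[symmetric]) blast
qed

section \<open>Adding one vertex to the tree\<close>

lemma exists_descent:
  fixes D :: "colour list set" and \<alpha> :: real
  assumes D: "finite D" and S: "finite S" and \<alpha>: "0 \<le> \<alpha>" "\<alpha> \<le> 1"
  obtains s S' where "s \<notin> D" and "\<And>p. strict_prefix p s \<Longrightarrow> p \<in> D" and "S' \<subseteq> S"
    and "\<And>p k w. prefix (p @ [k]) s \<Longrightarrow> w \<in> S' \<Longrightarrow> c {f p, v, w} = k"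
    and "\<alpha> ^ count_list s Red * (1 - \<alpha>) ^ count_list s Blue * card S \<le> card S'"
proof -
  \<comment> \<open>\<open>P s S'\<close> records a descent of \<open>v\<close> to position
    \<open>s\<close> with surviving set \<open>S'\<close>.\<close>
  define P where "P s S' \<longleftrightarrow> (\<forall>p. strict_prefix p s \<longrightarrow> p \<in> D) \<and> S' \<subseteq> S \<and>
    (\<forall>p k w. prefix (p @ [k]) s \<longrightarrow> w \<in> S' \<longrightarrow> c {f p, v, w} = k) \<and>
    \<alpha> ^ count_list s Red * (1 - \<alpha>) ^ count_list s Blue * card S \<le> card S'" for s S'
  have ext: "\<exists>k S''. P (s @ [k]) S''" if P: "P s S'" and s: "s \<in> D" for s S'
  proof -
    define T where "T k = {w \<in> S'. c {f s, v, w} = k}" for k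
    have fin: "finite S'"
      using P S by (auto simp: P_def intro: finite_subset)
    have "S' = T Red \<union> T Blue" "T Red \<inter> T Blue = {}"
      by (auto simp: T_def) (metis colour.exhaust)
    then have card: "card S' = card (T Red) + card (T Blue)"
      using fin by (metis card_Un_disjoint finite_Un)
    have *: "P (s @ [k]) (T k)"
      if "\<beta> * card S' \<le> card (T k)" "\<beta> = (case k of Red \<Rightarrow> \<alpha> | Blue \<Rightarrow> 1 - \<alpha>)" for k and \<beta> :: real
    proof -
      have "\<beta> \<ge> 0"
        using that(2) \<alpha> by (cases k) auto
      then have "\<beta> * (\<alpha> ^ count_list s Red * (1 - \<alpha>) ^ count_list s Blue * card S) \<le> \<beta> * card S'"
        using P by (intro mult_left_mono) (auto simp: P_def)
      with that have "\<alpha> ^ count_list (s @ [k]) Red * (1 - \<alpha>) ^ count_list (s @ [k]) Blue * card S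
          \<le> card (T k)"
        by (cases k) (auto simp: mult_ac)
      moreover have "\<forall>p. strict_prefix p (s @ [k]) \<longrightarrow> p \<in> D"
        using P s by (auto simp: P_def strict_prefix_def prefix_snoc)
      moreover have "\<forall>p l w. prefix (p @ [l]) (s @ [k]) \<longrightarrow> w \<in> T k \<longrightarrow> c {f p, v, w} = l"
        using P by (auto simp: P_def T_def)
      moreover have "T k \<subseteq> S"
        using P by (auto simp: P_def T_def)
      ultimately show ?thesis
        unfolding P_def by blast
    qed
    \<comment> \<open>The two colour classes partition \<open>S'\<close> and the required fractions
      add up to 1, so they cannot both fall short.\<close>
    have "\<alpha> * card S' \<le> card (T Red) \<or> (1 - \<alpha>) * card S' \<le> card (T Blue)"
      using card by (auto simp: algebra_simps)
    then show ?thesis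
      using *[of \<alpha> Red] *[of "1 - \<alpha>" Blue] by auto
  qed
  \<comment> \<open>The descent continues while it stays in \<open>D\<close>. Taking
    \<open>n\<close> beyond the length of every node of the finite set \<open>D\<close> forces it to
    leave.\<close>
  have "\<exists>s S'. P s S' \<and> (s \<notin> D \<or> length s = n)" for n
  proof (induction n)
    case 0
    have "P [] S"
      by (auto simp: P_def)
    then show ?case by blast
  next
    case (Suc n)
    then show ?case
      using ext by (metis length_append_singleton)
  qed
  then obtain s S' where s: "P s S'" "s \<notin> D \<or> length s = Suc (Max (insert 0 (length ` D)))"
    by blast
  have "s \<notin> D"
  proof
    assume "s \<in> D"
    then have "length s \<le> Max (insert 0 (length ` D))"
      using D by (intro Max_ge) auto
    with s \<open>s \<in> D\<close> show False by simp
  qed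
  then show thesis
    using s(1) that unfolding P_def by blast
qed

text \<open>The vertex \<open>v\<close> is placed where its descent leaves \<open>D\<close>. The
  loss of 1 in \<open>card S - 1\<close> is \<open>v\<close> itself; the parent
  \<open>butlast s\<close> is recorded so that the steps leading to \<open>s\<close> can be
  bounded.\<close>

lemma colour_tree_insert:
  fixes \<alpha> :: real
  assumes T: "colour_tree c V D f S" and S: "finite S" "v \<in> S" and \<alpha>: "0 \<le> \<alpha>" "\<alpha> \<le> 1"
  obtains s S' where "s \<notin> D" and "colour_tree c V (insert s D) (f(s := v)) S'"
    and "s \<noteq> [] \<Longrightarrow> butlast s \<in> D"
    and "\<alpha> ^ count_list s Red * (1 - \<alpha>) ^ count_list s Blue * (card S - 1) \<le> card S'"
proof -
  obtain s S' where s: "s \<notin> D" "\<And>p. strict_prefix p s \<Longrightarrow> p \<in> D" "S' \<subseteq> S - {v}"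
      "\<And>p k w. prefix (p @ [k]) s \<Longrightarrow> w \<in> S' \<Longrightarrow> c {f p, v, w} = k"
      "\<alpha> ^ count_list s Red * (1 - \<alpha>) ^ count_list s Blue * card (S - {v}) \<le> card S'"
    by (rule exists_descent[OF colour_treeD(1)[OF T] finite_Diff[OF S(1)] \<alpha>]) (rule that)
  \<comment> \<open>Since \<open>D\<close> is prefix-closed, \<open>s\<close> becomes a leaf, so
    changing \<open>f\<close> at \<open>s\<close> leaves the conditions among old nodes
    intact.\<close>
  have no_ext: "\<not> strict_prefix s q" "\<not> prefix (s @ [k]) q" if "q \<in> D" for q k
    using colour_treeD(2,3)[OF T that] s(1) append_prefixD by blast+
  have irr: "\<not> prefix (p @ [k]) p" for p and k :: colour
    by (auto simp: prefix_def)
  have neq: "p \<noteq> s" if "q \<in> D" "prefix (p @ [k]) q" for p q k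
    using no_ext(2) that by blast
  have neq': "p \<noteq> s" if "prefix (p @ [k]) s" for p k
    using irr that by blast
  have tree: "colour_tree c V (insert s D) (f(s := v)) S'"
    unfolding colour_tree_def
  proof (intro conjI allI impI ballI)
    show "finite (insert s D)"
      using colour_treeD(1)[OF T] by simp
    show "p \<in> insert s D" if "q \<in> insert s D" "strict_prefix p q" for p q
      using that s(2) colour_treeD(2)[OF T] by blast
    have vf: "v \<notin> f ` D" "v \<in> V"
      using colour_treeD(6,7)[OF T] S(2) by blast+
    have im: "(f(s := v)) ` insert s D = insert v (f ` D)"
      using s(1) by (auto simp: image_iff)
    show "inj_on (f(s := v)) (insert s D)"
      using colour_treeD(4)[OF T] s(1) vf by (auto simp: inj_on_def)
    show "(f(s := v)) ` insert s D \<subseteq> V"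
      using colour_treeD(5)[OF T] vf unfolding im by blast
    show "S' \<subseteq> V" "(f(s := v)) ` insert s D \<inter> S' = {}"
      using colour_treeD(6,7)[OF T] s(3) unfolding im by blast+
    show "c {(f(s := v)) p, (f(s := v)) q, (f(s := v)) r} = k"
      if q: "q \<in> insert s D" and r: "r \<in> insert s D" and pq: "prefix (p @ [k]) q"
        and qr: "strict_prefix q r" for p q r k
    proof -
      have qD: "q \<in> D" "q \<noteq> s" "p \<noteq> s"
      proof -
        show "q \<noteq> s"
          using r qr no_ext(1) by auto
        with q show "q \<in> D"
          by simp
        then show "p \<noteq> s"
          using pq neq by blast
      qed
      \<comment> \<open>If \<open>r = s\<close>, the third vertex is \<open>v\<close>, which came
        from \<open>S\<close>, so the old condition on \<open>S\<close> applies.\<close>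
      show ?thesis
      proof (cases "r = s")
        case True
        then show ?thesis
          using qD pq S(2) colour_treeD(9)[OF T] by auto
      next
        case False
        then show ?thesis
          using qD pq qr r colour_treeD(8)[OF T] by auto
      qed
    qed
    show "c {(f(s := v)) p, (f(s := v)) q, w} = k"
      if q: "q \<in> insert s D" and w: "w \<in> S'" and pq: "prefix (p @ [k]) q" for p q w k
    proof (cases "q = s")
      case True
      then show ?thesis
        using s(4) w pq neq' by auto
    next
      case False
      then show ?thesis
        using q w pq neq s(3) colour_treeD(9)[OF T] by auto
    qed
  qed
  have "strict_prefix (butlast s) s" if "s \<noteq> []"
    by (metis append_butlast_last_id strict_prefixI' that)
  then have "s \<noteq> [] \<Longrightarrow> butlast s \<in> D"
    using s(2) by blast
  then show thesis
    using that[OF s(1) tree] s(5) S by simp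
qed

lemma colour_tree_grow:
  assumes T: "colour_tree c {..<N} D f S" and S: "2 \<le> card S" and t: "1 \<le> t"
    and "\<not> contains_copy (colour_class (complete3 N) c Red) K5_minus"
    and "\<not> contains_copy (colour_class (complete3 N) c Blue) (complete3 t)"
  obtains D' f' S' where "colour_tree c {..<N} D' f' S'" and "card D' = Suc (card D)"
    and "card S \<le> 32 * t ^ 3 * card S'"
proof -
  have fin: "finite S" and "S \<noteq> {}"
    using S by (auto simp: card_ge_0_finite)
  then obtain v where v: "v \<in> S"
    by blast
  \<comment> \<open>Red steps are few, so each may cost a factor \<open>2 * t\<close>; up to
    \<open>t\<close> blue steps together cost at most a factor 2, by Bernoulli.\<close>
  define \<alpha> :: real where "\<alpha> = 1 / (2 * t)"
  have \<alpha>: "0 \<le> \<alpha>" "\<alpha> \<le> 1"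
    using t by (auto simp: \<alpha>_def)
  obtain s S' where s: "s \<notin> D" "colour_tree c {..<N} (insert s D) (f(s := v)) S'"
      "s \<noteq> [] \<Longrightarrow> butlast s \<in> D"
      "\<alpha> ^ count_list s Red * (1 - \<alpha>) ^ count_list s Blue * (card S - 1) \<le> card S'"
    using colour_tree_insert[OF T fin v \<alpha>] by metis
  have thin: "D \<subseteq> thin t"
    using colour_tree_thin[OF T \<open>S \<noteq> {}\<close> assms(4,5)] .
  \<comment> \<open>As \<open>S'\<close> is not yet known to be nonempty, the bound goes through the
    parent, which is thin; the last step adds at most one to either count.\<close>
  have "count_list s Red \<le> 3 \<and> count_list s Blue \<le> t"
  proof (cases "s = []")
    case False
    then obtain u k where u: "s = u @ [k]"
      by (metis rev_exhaust)
    then have "u \<in> thin t"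
      using s(3) thin by auto
    moreover have "count_list u Red \<le> Suc (count_list (butlast u) Red)"
      by (cases u rule: rev_cases) auto
    ultimately show ?thesis
      using u by (auto simp: thin_def)
  qed simp
  then have R: "\<alpha> ^ 3 \<le> \<alpha> ^ count_list s Red" and "(1 - \<alpha>) ^ t \<le> (1 - \<alpha>) ^ count_list s Blue"
    using \<alpha> by (auto intro: power_decreasing)
  moreover have "1 / 2 \<le> (1 - \<alpha>) ^ t"
    using Bernoulli_inequality[of "- \<alpha>" t] \<alpha> t by (simp add: \<alpha>_def)
  ultimately have "\<alpha> ^ 3 * (1 / 2) \<le> \<alpha> ^ count_list s Red * (1 - \<alpha>) ^ count_list s Blue"
    using \<alpha> by (intro mult_mono) auto
  then have "\<alpha> ^ 3 * (1 / 2) * (card S / 2) \<le>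
      \<alpha> ^ count_list s Red * (1 - \<alpha>) ^ count_list s Blue * (card S - 1)"
    using \<alpha> S by (intro mult_mono[of "\<alpha> ^ 3 * (1 / 2)"]) auto
  also note s(4)
  \<comment> \<open>The constant is 8 * 2 * 2: from the cube of \<open>\<alpha>\<close>, from the
    blue steps, and from \<open>card S - 1\<close> being at least half of
    \<open>card S\<close>.\<close>
  finally have "card S \<le> 32 * real t ^ 3 * card S'"
    using t by (simp add: \<alpha>_def field_simps)
  then have "card S \<le> 32 * t ^ 3 * card S'"
    by (metis (mono_tags, lifting) of_nat_le_iff of_nat_mult of_nat_numeral of_nat_power)
  then show thesis
    using that s(1,2) colour_treeD(1)[OF T] by simp
qed

section \<open>Iteration and the final estimate\<close>

lemma ramsey_arrow_K5_minus:
  assumes t: "1 \<le> t"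
  shows "ramsey_arrow (2 * (32 * t ^ 3) ^ (3 * t\<^sup>2 + 1)) K5_minus (complete3 t)"
proof (unfold ramsey_arrow_def, intro allI, rule ccontr)
  \<comment> \<open>One more node than \<open>thin t\<close> can hold; reaching \<open>m\<close>
    nodes is the contradiction.\<close>
  define m where "m = 3 * t\<^sup>2 + 1"
  define b where "b = 32 * t ^ 3"
  define N where "N = 2 * b ^ m"
  fix c :: "nat set \<Rightarrow> colour"
  assume "\<not> (contains_copy (colour_class (complete3 (2 * (32 * t ^ 3) ^ (3 * t\<^sup>2 + 1))) c Red) K5_minus \<or>
     contains_copy (colour_class (complete3 (2 * (32 * t ^ 3) ^ (3 * t\<^sup>2 + 1))) c Blue) (complete3 t))"
  then have no: "\<not> contains_copy (colour_class (complete3 N) c Red) K5_minus"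
      "\<not> contains_copy (colour_class (complete3 N) c Blue) (complete3 t)"
    by (simp_all add: N_def m_def b_def)
  have b: "b > 0"
    using t by (simp add: b_def)
  \<comment> \<open>The factor 2 keeps at least two vertices in \<open>S\<close> throughout, as each
    growth step requires, and leaves \<open>S\<close> nonempty at the end.\<close>
  have "\<exists>D f S. colour_tree c {..<N} D f S \<and> card D = n \<and> 2 * b ^ (m - n) \<le> card S" if "n \<le> m" for n
    using that
  proof (induction n)
    case 0
    have "colour_tree c {..<N} {} (\<lambda>_. 0) {..<N}"
      by (simp add: colour_tree_def)
    then show ?case
      by (metis N_def card.empty card_lessThan diff_zero order_refl)
  next
    case (Suc n)
    then obtain D f S where IH: "colour_tree c {..<N} D f S" "card D = n" "2 * b ^ (m - n) \<le> card S"
      by auto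
    have "1 \<le> b ^ (m - n)"
      using b by simp
    then have "2 \<le> card S"
      using IH(3) by linarith
    then obtain D' f' S' where S': "colour_tree c {..<N} D' f' S'" "card D' = Suc n"
        "card S \<le> b * card S'"
      using colour_tree_grow[OF IH(1) _ t no] IH(2) unfolding b_def by metis
    have "b * (2 * b ^ (m - Suc n)) = 2 * b ^ (m - n)"
      using Suc.prems by (metis Suc_diff_Suc Suc_le_lessD mult.left_commute power_Suc)
    then have "2 * b ^ (m - Suc n) \<le> card S'"
      using IH(3) S'(3) b by (metis le_trans mult_le_cancel1)
    with S' show ?case by blast
  qed
  then obtain D f S where D: "colour_tree c {..<N} D f S" "card D = m" "2 \<le> card S"
    by fastforce
  then have "D \<subseteq> thin t"
    using colour_tree_thin[OF D(1) _ no] by fastforce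
  then have "m \<le> 3 * t\<^sup>2"
    using card_thin D(2) by (metis card_mono le_trans)
  then show False
    by (simp add: m_def)
qed

theorem mainTheorem2:
  shows "\<exists>C::real. C > 0 \<and>
    (\<forall>\<^sub>F t :: nat in sequentially.
       real (ramsey_number K5_minus (complete3 t)) \<le> 2 powr (C * (real t)\<^sup>2 * log 2 (real t)))"
proof (intro exI conjI)
  show "\<forall>\<^sub>F t :: nat in sequentially.
    real (ramsey_number K5_minus (complete3 t)) \<le> 2 powr (33 * (real t)\<^sup>2 * log 2 (real t))"
  proof (rule eventually_sequentiallyI[of 2])
    fix t :: nat assume t: "2 \<le> t"
    define m where "m = 3 * t\<^sup>2 + 1"
    define L where "L = log 2 (real t)"
    have L: "1 \<le> L" and tL: "real t = 2 powr L"
      using t by (auto simp: L_def le_log_iff)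
    have "ramsey_number K5_minus (complete3 t) \<le> 2 * (32 * t ^ 3) ^ m"
      unfolding ramsey_number_def m_def using t by (intro Least_le ramsey_arrow_K5_minus) simp
    then have "real (ramsey_number K5_minus (complete3 t)) \<le> real (2 * (32 * t ^ 3) ^ m)"
      by (rule of_nat_mono)
    also have "\<dots> = 2 powr 1 * (2 powr 5 * (2 powr L) ^ 3) ^ m"
      by (simp add: tL)
    also have "\<dots> = 2 powr (1 + (5 + L * 3) * m)"
      by (simp only: powr_power powr_add[symmetric]) (simp add: powr_power powr_add[symmetric] mult_ac)
    also have "\<dots> \<le> 2 powr (33 * (real t)\<^sup>2 * L)"
    proof (intro powr_mono)
      have sq: "1 \<le> (real t)\<^sup>2"
        using t by (simp add: one_le_power)
      \<comment> \<open>With \<open>L\<close> at least 1, the bracket is at most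
        \<open>8 * L\<close>, and \<open>m\<close> is at most four times the square of
        \<open>t\<close>. The summand 1 is absorbed as well, giving 33 = 1 + 8 * 4.\<close>
      have "1 + (5 + L * 3) * m \<le> L + (5 * L + L * 3) * (4 * (real t)\<^sup>2)"
        using L sq by (intro add_mono mult_mono) (auto simp: m_def)
      also have "\<dots> \<le> L * (real t)\<^sup>2 + (5 * L + L * 3) * (4 * (real t)\<^sup>2)"
        using L sq by simp
      finally show "1 + (5 + L * 3) * m \<le> 33 * (real t)\<^sup>2 * L"
        by (simp add: algebra_simps)
    qed simp
    finally show "real (ramsey_number K5_minus (complete3 t)) \<le> 2 powr (33 * (real t)\<^sup>2 * log 2 (real t))"
      by (simp add: L_def)
  qed
qed simp

end
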